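(* Let $G$ be a non-trivial finite simple group of order $n$. Then $\lambda(\mathcal{P}_E(G))=n$ if and only if $G$ is not a cyclic group of order $n\geq 3$.
   Context: The enhanced power graph $\mathcal{P}_E(G)$ of a finite group $G$ is the simple undirected graph with vertex set $G$ in which two distinct vertices $x,y$ are adjacent if there is $z\in G$ with $x,y\in\langle z\rangle$. An $L(2,1)$-labeling of a finite graph $\Gamma$ is an integer-valued function $f$ on $V(\Gamma)$ such that $|f(u)-f(v)|\geq 2$ whenever $u,v$ are adjacent and $|f(u)-f(v)|\geq 1$ whenever $u,v$ are at distance $2$. Its span is the difference between the maximum and the minimum of $f$. The $\lambda$-number $\lambda(\Gamma)$ is the minimum span over all $L(2,1)$-labelings of $\Gamma$. *)

theory Defs
  imports
    "HOL-Algebra.Elementary_Groups"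
    "HOL-Algebra.SimpleGroups"
    "Graph_Theory.Pair_Digraph"
    "Graph_Theory.Shortest_Path"
begin

text \<open>
  A finite simple undirected graph is a \<^locale>\<open>pair_graph\<close>: every edge is present as two opposite
  arcs.
\<close>

definition enhanced_power_graph :: "('a, 'b) monoid_scheme \<Rightarrow> 'a pair_pre_digraph" where
  "enhanced_power_graph G =
     \<lparr>pverts = carrier G,
      parcs = {(x, y). x \<in> carrier G \<and> y \<in> carrier G \<and> x \<noteq> y \<and>
                 (\<exists>z \<in> carrier G. x \<in> generate G {z} \<and> y \<in> generate G {z})}\<rparr>"

lemma pair_graph_enhanced_power_graph:
  assumes "finite (carrier G)"
  shows "pair_graph (enhanced_power_graph G)"
proof
  have "parcs (enhanced_power_graph G) \<subseteq> carrier G \<times> carrier G"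
    by (auto simp: enhanced_power_graph_def)
  then show "finite (parcs (enhanced_power_graph G))"
    using assms by (meson finite_SigmaI finite_subset)
qed (use assms in \<open>auto simp: enhanced_power_graph_def symmetric_def sym_def\<close>)

text \<open>The usual distance is the shortest-path distance in which every edge has length 1.\<close>

definition graph_dist :: "'a pair_pre_digraph \<Rightarrow> 'a \<Rightarrow> 'a \<Rightarrow> ereal" where
  "graph_dist \<Gamma> u v = wf_digraph.\<mu> (with_proj \<Gamma>) (\<lambda>_. 1) u v"

definition L21_labeling :: "'a pair_pre_digraph \<Rightarrow> ('a \<Rightarrow> int) \<Rightarrow> bool" where
  "L21_labeling \<Gamma> f \<longleftrightarrow>
     (\<forall>u \<in> pverts \<Gamma>. \<forall>v \<in> pverts \<Gamma>.
        ((u, v) \<in> parcs \<Gamma> \<longrightarrow> \<bar>f u - f v\<bar> \<ge> 2) \<and>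
        (graph_dist \<Gamma> u v = 2 \<longrightarrow> \<bar>f u - f v\<bar> \<ge> 1))"

definition labeling_span :: "'a pair_pre_digraph \<Rightarrow> ('a \<Rightarrow> int) \<Rightarrow> int" where
  "labeling_span \<Gamma> f = Max (f ` pverts \<Gamma>) - Min (f ` pverts \<Gamma>)"

text \<open>
  On a finite graph with at least one vertex every span is a natural number, and some labeling
  exists (see below), so the \<open>LEAST\<close> is an attained minimum.
\<close>

definition lambda_number :: "'a pair_pre_digraph \<Rightarrow> nat" where
  "lambda_number \<Gamma> = (LEAST k. \<exists>f. L21_labeling \<Gamma> f \<and> labeling_span \<Gamma> f = int k)"

lemma lambda_number_attained:
  assumes "pair_graph \<Gamma>" and "pverts \<Gamma> \<noteq> {}"
  shows "\<exists>f. L21_labeling \<Gamma> f \<and> labeling_span \<Gamma> f = int (lambda_number \<Gamma>)"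
proof -
  interpret pair_graph \<Gamma> by fact
  have fin: "finite (pverts \<Gamma>)" by (rule pair_finite_verts)
  then obtain g :: "'a \<Rightarrow> nat" where g: "inj_on g (pverts \<Gamma>)"
    using finite_imp_inj_to_nat_seg by blast
  define f where "f = (\<lambda>v. 2 * int (g v))"
  have sep: "\<bar>f u - f v\<bar> \<ge> 2" if "u \<in> pverts \<Gamma>" "v \<in> pverts \<Gamma>" "u \<noteq> v" for u v
  proof -
    have "g u \<noteq> g v" using g that by (auto dest: inj_onD)
    then show ?thesis by (auto simp: f_def)
  qed
  have dist0: "graph_dist \<Gamma> u u \<noteq> 2" if "u \<in> pverts \<Gamma>" for u
  proof -
    have "awalk u [] u" using that by (simp add: awalk_Nil_iff)
    from min_cost_le_walk_cost[OF this, of "\<lambda>_. 1"]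
    have "graph_dist \<Gamma> u u \<le> 0" by (simp add: graph_dist_def zero_ereal_def)
    then show ?thesis by fastforce
  qed
  have "L21_labeling \<Gamma> f"
    unfolding L21_labeling_def
  proof (intro ballI conjI impI)
    fix u v assume uv: "u \<in> pverts \<Gamma>" "v \<in> pverts \<Gamma>"
    show "\<bar>f u - f v\<bar> \<ge> 2" if "(u, v) \<in> parcs \<Gamma>"
      using sep[OF uv] pair_no_loops[OF that] by simp
    show "\<bar>f u - f v\<bar> \<ge> 1" if "graph_dist \<Gamma> u v = 2"
      using sep[OF uv] dist0[OF uv(1)] that by fastforce
  qed
  moreover have "labeling_span \<Gamma> f \<ge> 0"
    using fin assms(2) by (simp add: labeling_span_def)
  ultimately have "\<exists>k f. L21_labeling \<Gamma> f \<and> labeling_span \<Gamma> f = int k"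
    by (metis nonneg_int_cases)
  then show ?thesis
    unfolding lambda_number_def by (rule LeastI_ex)
qed

end

theory Submission
  imports Defs
begin

text \<open>
  Write \<open>n\<close> for the order of the simple group \<open>G\<close> and \<open>\<Gamma>\<close> for its enhanced power graph. The
  identity is adjacent to every other vertex, so any two vertices are at distance at most 2 and an
  \<open>L(2,1)\<close>-labeling is injective. As the label of the identity also has an unused integer next to
  it, every span is at least \<open>n\<close> (\<open>lambda_number_ge_dominated\<close>). Conversely, a Hamiltonian path in
  the complement of \<open>\<Gamma>\<close> on the \<open>n - 1\<close> non-identity elements yields a labeling of span \<open>n\<close>:
  number the elements along the path by \<open>0, \<dots>, n - 2\<close> and give the identity the label \<open>n\<close>
  (\<open>lambda_number_le_hamiltonian\<close>).

  Suppose \<open>G\<close> is not cyclic. Elements of a common cyclic subgroup commute, so the vertices equal or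
  adjacent to \<open>x \<noteq> \<one>\<close> lie in the centralizer of \<open>x\<close>. The centre is a normal subgroup; were it all
  of \<open>G\<close>, then \<open>G\<close> would be a commutative simple group and hence cyclic. So the centre is trivial,
  the centralizer is a proper subgroup, and it has at most \<open>n/2\<close> elements. Hence in the complement
  every one of the \<open>n - 1\<close> non-identity elements has at least \<open>n/2\<close> neighbours, and the required
  path exists by Dirac's theorem (\<open>dirac_hamiltonian_cycle\<close>).

  Suppose \<open>G\<close> is cyclic. Then \<open>\<Gamma>\<close> is complete and every span is at least \<open>2(n - 1)\<close>, which exceeds
  \<open>n\<close> for \<open>n \<ge> 3\<close>. For \<open>n = 2\<close> the Hamiltonian path above is a single vertex.
\<close>

section \<open>Hamiltonian cycles in dense relations\<close>

text \<open>The number of consecutive pairs of a list that are not related by \<open>R\<close>.\<close>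

fun breaks :: "('a \<Rightarrow> 'a \<Rightarrow> bool) \<Rightarrow> 'a list \<Rightarrow> nat" where
  "breaks R [] = 0"
| "breaks R [x] = 0"
| "breaks R (x # y # zs) = of_bool (\<not> R x y) + breaks R (y # zs)"

lemma breaks_append:
  assumes "xs \<noteq> []" and "ys \<noteq> []"
  shows "breaks R (xs @ ys) = breaks R xs + of_bool (\<not> R (last xs) (hd ys)) + breaks R ys"
  using assms
proof (induction R xs rule: breaks.induct)
  case (2 R x)
  then show ?case by (cases ys) auto
qed auto

lemma breaks_rev:
  assumes "symp R"
  shows "breaks R (rev xs) = breaks R xs"
  using assms
proof (induction R xs rule: breaks.induct)
  case (3 R x y zs)
  have "breaks R (rev (x # y # zs)) = breaks R (rev (y # zs)) + of_bool (\<not> R y x)"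
    using breaks_append[of "rev (y # zs)" "[x]" R] by (simp add: last_rev)
  moreover have "R y x = R x y"
    using 3 by (auto elim: sympE)
  ultimately show ?case using 3 by simp
qed auto

lemma breaks_eq_0_iff: "breaks R xs = 0 \<longleftrightarrow> successively R xs"
  by (induction R xs rule: breaks.induct) auto

lemma not_successively_split:
  assumes "\<not> successively R xs"
  obtains as bs where "xs = as @ bs" and "as \<noteq> []" and "bs \<noteq> []" and "\<not> R (last as) (hd bs)"
proof -
  have "\<exists>as bs. xs = as @ bs \<and> as \<noteq> [] \<and> bs \<noteq> [] \<and> \<not> R (last as) (hd bs)"
    using assms
  proof (induction R xs rule: breaks.induct)
    case (3 R x y zs)
    show ?case
    proof (cases "R x y")
      case True
      with 3 obtain as bs where
        "y # zs = as @ bs" "as \<noteq> []" "bs \<noteq> []" "\<not> R (last as) (hd bs)"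
        by auto
      then show ?thesis
        by (intro exI[of _ "x # as"] exI[of _ bs]) auto
    next
      case False
      then show ?thesis
        by (intro exI[of _ "[x]"] exI[of _ "y # zs"]) auto
    qed
  qed auto
  then show thesis using that by blast
qed

text \<open>
  The same count for the list read as a closed cycle: the step from the last element back to the
  first is included. Only nonempty lists are meant. A singleton list has the loop at its element as
  its closing step.
\<close>

definition cyclic_breaks :: "('a \<Rightarrow> 'a \<Rightarrow> bool) \<Rightarrow> 'a list \<Rightarrow> nat" where
  "cyclic_breaks R xs = breaks R xs + of_bool (\<not> R (last xs) (hd xs))"

lemma cyclic_breaks_eq_0_iff:
  "cyclic_breaks R xs = 0 \<longleftrightarrow> successively R xs \<and> R (last xs) (hd xs)"
  by (simp add: cyclic_breaks_def breaks_eq_0_iff)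

lemma cyclic_breaks_rotate:
  assumes "as \<noteq> []" and "bs \<noteq> []"
  shows "cyclic_breaks R (bs @ as) = cyclic_breaks R (as @ bs)"
  using assms by (simp add: cyclic_breaks_def breaks_append)

lemma cyclic_breaks_rotate_to_ends:
  assumes "cyclic_breaks R xs \<noteq> 0"
  obtains ys where "set ys = set xs" and "length ys = length xs"
    and "cyclic_breaks R ys = cyclic_breaks R xs" and "\<not> R (last ys) (hd ys)"
proof (cases "R (last xs) (hd xs)")
  case True
  with assms have "\<not> successively R xs"
    by (simp add: cyclic_breaks_eq_0_iff)
  then obtain as bs where
    ab: "xs = as @ bs" "as \<noteq> []" "bs \<noteq> []" "\<not> R (last as) (hd bs)"
    by (rule not_successively_split)
  show thesis
    by (rule that[of "bs @ as"]) (use ab in \<open>auto simp: cyclic_breaks_rotate\<close>)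
next
  case False
  then show thesis using that by blast
qed

text \<open>
  The pigeonhole step of Dirac's theorem: the positions just before a neighbour of the first element
  and the positions of neighbours of the last element lie among \<open>length xs - 1\<close> positions, so by the
  degree hypothesis some position is of both kinds.
\<close>

lemma crossing_split:
  assumes irrefl: "\<And>x. \<not> R x x" and ne: "xs \<noteq> []"
    and deg: "length xs \<le> card {w \<in> set xs. R (hd xs) w} + card {w \<in> set xs. R (last xs) w}"
  obtains as bs where "xs = as @ bs" and "as \<noteq> []" and "bs \<noteq> []"
    and "R (hd xs) (hd bs)" and "R (last xs) (last as)"
proof -
  define m where "m = length xs"
  define A where "A = {i. Suc i < m \<and> R (hd xs) (xs ! Suc i)}"
  define B where "B = {i. Suc i < m \<and> R (last xs) (xs ! i)}"
  have sub: "A \<union> B \<subseteq> {..<m - 1}"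
    by (auto simp: A_def B_def)
  then have fin: "finite A" "finite B"
    by (auto intro: finite_subset)
  have hd_last: "hd xs = xs ! 0" "last xs = xs ! (m - 1)" and m: "m > 0"
    using ne by (auto simp: hd_conv_nth last_conv_nth m_def)
  have "{w \<in> set xs. R (hd xs) w} \<subseteq> (\<lambda>i. xs ! Suc i) ` A"
  proof
    fix w assume w: "w \<in> {w \<in> set xs. R (hd xs) w}"
    then obtain i where i: "i < m" "w = xs ! i"
      by (auto simp: in_set_conv_nth m_def)
    have "i \<noteq> 0"
      using w i irrefl hd_last(1) by (metis (no_types, lifting) mem_Collect_eq)
    then obtain j where "i = Suc j"
      by (cases i) auto
    then show "w \<in> (\<lambda>i. xs ! Suc i) ` A"
      using w i by (auto simp: A_def)
  qed
  then have A: "card {w \<in> set xs. R (hd xs) w} \<le> card A"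
    using fin(1) by (meson card_image_le card_mono finite_imageI le_trans)
  have "{w \<in> set xs. R (last xs) w} \<subseteq> (\<lambda>i. xs ! i) ` B"
  proof
    fix w assume w: "w \<in> {w \<in> set xs. R (last xs) w}"
    then obtain i where i: "i < m" "w = xs ! i"
      by (auto simp: in_set_conv_nth m_def)
    have "i \<noteq> m - 1"
      using w i irrefl hd_last(2) by (metis (no_types, lifting) mem_Collect_eq)
    then show "w \<in> (\<lambda>i. xs ! i) ` B"
      using w i by (auto simp: B_def)
  qed
  then have B: "card {w \<in> set xs. R (last xs) w} \<le> card B"
    using fin(2) by (meson card_image_le card_mono finite_imageI le_trans)
  have "A \<inter> B \<noteq> {}"
  proof
    assume "A \<inter> B = {}"
    then have "card A + card B = card (A \<union> B)"
      using fin by (simp add: card_Un_disjoint)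
    also have "\<dots> \<le> m - 1"
      using card_mono[OF _ sub] by simp
    finally show False
      using A B deg m unfolding m_def by linarith
  qed
  then obtain i where i: "Suc i < m" "R (hd xs) (xs ! Suc i)" "R (last xs) (xs ! i)"
    by (auto simp: A_def B_def)
  show thesis
  proof (rule that[of "take (Suc i) xs" "drop (Suc i) xs"])
    show "R (hd xs) (hd (drop (Suc i) xs))"
      using i by (simp add: hd_drop_conv_nth m_def)
    show "R (last xs) (last (take (Suc i) xs))"
      using i by (simp add: take_Suc_conv_app_nth m_def)
  qed (use i ne in \<open>auto simp: m_def\<close>)
qed

text \<open>
  Dirac's theorem for a symmetric irreflexive relation: it holds because a cyclic arrangement of \<open>V\<close>
  with as few breaks as possible has none. If there were a break, it could be rotated to the closing
  step; then \<open>crossing_split\<close> gives a place where reversing the tail reduces the number of breaks.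
  For a set of two elements the conclusion is the degenerate cycle that uses the same pair twice.
\<close>

theorem dirac_hamiltonian_cycle:
  assumes fin: "finite V" and ne: "V \<noteq> {}"
    and sym: "symp R" and irrefl: "\<And>x. \<not> R x x"
    and deg: "\<And>v. v \<in> V \<Longrightarrow> card V \<le> 2 * card {w \<in> V. R v w}"
  obtains xs where "distinct xs" and "set xs = V"
    and "successively R xs" and "R (last xs) (hd xs)"
proof -
  \<comment> \<open>Equality of the two sizes makes such a list free of repetitions.\<close>
  define arr where "arr xs \<longleftrightarrow> set xs = V \<and> length xs = card V" for xs
  obtain xs0 where "arr xs0"
    using fin distinct_card by (metis arr_def finite_distinct_list)
  then obtain xs where xs: "arr xs"
    and least: "\<And>ys. arr ys \<Longrightarrow> cyclic_breaks R xs \<le> cyclic_breaks R ys"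
    using ex_has_least_nat[of arr xs0 "cyclic_breaks R"] by blast
  have "cyclic_breaks R xs = 0"
  proof (rule ccontr)
    assume "cyclic_breaks R xs \<noteq> 0"
    then obtain ys where ys: "set ys = set xs" "length ys = length xs"
      "cyclic_breaks R ys = cyclic_breaks R xs" "\<not> R (last ys) (hd ys)"
      by (rule cyclic_breaks_rotate_to_ends)
    have setys: "set ys = V" and len: "length ys = card V"
      using ys xs by (auto simp: arr_def)
    have ne': "ys \<noteq> []"
      using setys ne by auto
    have "length ys \<le> card {w \<in> set ys. R (hd ys) w} + card {w \<in> set ys. R (last ys) w}"
      using deg[of "hd ys"] deg[of "last ys"] hd_in_set[OF ne'] last_in_set[OF ne']
      unfolding len setys by linarith
    then obtain as bs where ab: "ys = as @ bs" "as \<noteq> []" "bs \<noteq> []"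
      "R (hd ys) (hd bs)" "R (last ys) (last as)"
      using crossing_split[of R ys] irrefl ne' by blast
    have R: "R (last as) (last bs)" "R (hd bs) (hd as)" "\<not> R (last bs) (hd as)"
      using ab ys(4) sym by (auto elim: sympE)
    \<comment> \<open>Reversing the second block trades the closing step and the step between the blocks
      for two related ones.\<close>
    have "cyclic_breaks R (as @ rev bs) = breaks R as + breaks R bs"
      using ab R by (simp add: cyclic_breaks_def breaks_append breaks_rev[OF sym] hd_rev last_rev)
    also have "\<dots> < cyclic_breaks R ys"
      using ab R by (simp add: cyclic_breaks_def breaks_append)
    finally have "cyclic_breaks R (as @ rev bs) < cyclic_breaks R xs"
      using ys by simp
    moreover have "arr (as @ rev bs)"
      using ab setys len by (auto simp: arr_def)
    ultimately show False
      using least by (meson not_le)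
  qed
  moreover have "distinct xs"
    using xs by (auto simp: arr_def intro: card_distinct)
  ultimately show thesis
    using that xs by (auto simp: arr_def cyclic_breaks_eq_0_iff)
qed

section \<open>The \<open>\<lambda>\<close>-number of a graph with a dominating vertex\<close>

lemma (in pair_graph) graph_dist_refl:
  assumes "v \<in> pverts G"
  shows "graph_dist G v v = 0"
proof (rule antisym)
  have "awalk v [] v"
    using assms by (simp add: awalk_Nil_iff)
  from min_cost_le_walk_cost[OF this, of "\<lambda>_. 1"] show "graph_dist G v v \<le> 0"
    by (simp add: graph_dist_def zero_ereal_def)
  show "0 \<le> graph_dist G v v"
    unfolding graph_dist_def \<mu>_def
    by (rule INF_greatest) (use pos_cost_pos_awalk_cost[of v _ v "\<lambda>_. 1"] in auto)
qed

lemma (in pair_graph) graph_dist_eq_2: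
  assumes uc: "(u, c) \<in> parcs G" and cv: "(c, v) \<in> parcs G"
    and "u \<noteq> v" and "(u, v) \<notin> parcs G"
  shows "graph_dist G u v = 2"
proof (rule antisym)
  have "awalk u [(u, c), (c, v)] v"
    using uc cv in_arcsD2[OF cv] by (auto simp: awalk_Cons_iff awalk_Nil_iff)
  from min_cost_le_walk_cost[OF this, of "\<lambda>_. 1"] show "graph_dist G u v \<le> 2"
    by (simp add: graph_dist_def)
  have cost: "awalk_cost (\<lambda>_. 1 :: real) p = length p" for p :: "('a \<times> 'a) list"
    by (induction p) auto
  show "2 \<le> graph_dist G u v"
    unfolding graph_dist_def \<mu>_def
  proof (rule INF_greatest)
    fix p assume "p \<in> {p. awalk u p v}"
    then have p: "awalk u p v" by simp
    have "p \<noteq> []"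
      using p assms by (auto simp: awalk_Nil_iff)
    moreover have "p \<noteq> [a]" for a
      using p assms by (cases a) (auto simp: awalk_Cons_iff awalk_Nil_iff)
    ultimately have "2 \<le> length p"
      by (metis One_nat_def Suc_leI length_0_conv length_Suc_conv less_2_cases_iff not_less
          numeral_2_eq_2)
    then have "2 \<le> real (length p)" by simp
    then show "2 \<le> ereal (awalk_cost (\<lambda>_. 1) p)"
      unfolding cost by simp
  qed
qed

lemma labels_in_span:
  assumes "finite (pverts \<Gamma>)"
  shows "f ` pverts \<Gamma> \<subseteq> {Min (f ` pverts \<Gamma>) .. Min (f ` pverts \<Gamma>) + labeling_span \<Gamma> f}"
  using assms by (auto simp: labeling_span_def)

text \<open>
  If \<open>c\<close> is adjacent to all other vertices, two distinct vertices are adjacent or at distance 2.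
\<close>

lemma (in pair_graph) dominated_labeling_inj:
  assumes c: "c \<in> pverts G" and dom: "\<And>v. v \<in> pverts G - {c} \<Longrightarrow> (c, v) \<in> parcs G"
    and f: "L21_labeling G f"
  shows "inj_on f (pverts G)"
proof (rule inj_onI, rule ccontr)
  fix u v assume uv: "u \<in> pverts G" "v \<in> pverts G" "f u = f v" "u \<noteq> v"
  then have nadj: "(u, v) \<notin> parcs G"
    using f by (force simp: L21_labeling_def)
  then have "u \<noteq> c" "v \<noteq> c"
    using uv dom arcs_symmetric by blast+
  then have "graph_dist G u v = 2"
    using uv nadj dom arcs_symmetric by (intro graph_dist_eq_2[of _ c]) blast+
  then show False
    using f uv by (force simp: L21_labeling_def)
qed

lemma (in pair_graph) lambda_number_ge_dominated:
  assumes c: "c \<in> pverts G" and dom: "\<And>v. v \<in> pverts G - {c} \<Longrightarrow> (c, v) \<in> parcs G"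
    and card: "card (pverts G) \<ge> 2"
  shows "card (pverts G) \<le> lambda_number G"
proof -
  let ?V = "pverts G"
  obtain f where f: "L21_labeling G f" and span: "labeling_span G f = int (lambda_number G)"
    using lambda_number_attained[OF pair_graph] c by blast
  define a where "a = Min (f ` ?V)"
  define b where "b = a + int (lambda_number G)"
  have range: "f ` ?V \<subseteq> {a..b}"
    using labels_in_span[of G f] by (simp add: span a_def b_def)
  have inj: "inj_on f ?V"
    using dominated_labeling_inj[OF c dom f] .
  have gap: "\<bar>f c - f v\<bar> \<ge> 2" if "v \<in> ?V" "v \<noteq> c" for v
    using f dom[of v] c that by (auto simp: L21_labeling_def)
  \<comment> \<open>A second vertex makes the interval of labels extend beyond \<open>f c\<close> on one side; the integer next
    to \<open>f c\<close> on that side cannot be a label.\<close>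
  obtain w where w: "w \<in> ?V" "w \<noteq> c"
    using card c by (metis One_nat_def Suc_1 card_1_singleton_iff card_le_Suc0_iff_eq
        not_less_eq_eq pair_finite_verts)
  have "f w \<in> {a..b}" "f c \<in> {a..b}"
    using range w c by blast+
  then obtain t where t: "t \<in> {a..b}" "\<bar>f c - t\<bar> = 1"
    using gap[OF w] by (cases "f c < f w") (auto intro: that[of "f c + 1"] that[of "f c - 1"])
  have "t \<notin> f ` ?V"
    using gap t by force
  then have "Suc (card ?V) = card (insert t (f ` ?V))"
    using inj by (simp add: card_image)
  also have "\<dots> \<le> card {a..b}"
    using range t by (intro card_mono) auto
  also have "\<dots> = Suc (lambda_number G)"
    by (simp add: b_def)
  finally show ?thesis by simp
qed

text \<open>
  The path visits all vertices except \<open>c\<close>. Labels that differ by exactly 1 occur only at consecutive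
  vertices of the path, which are not adjacent. Nothing is assumed about the neighbours of \<open>c\<close>: its
  label \<open>length xs + 1\<close> is at least 2 away from all others.
\<close>

lemma (in pair_graph) lambda_number_le_hamiltonian:
  assumes c: "c \<in> pverts G" and card: "card (pverts G) \<ge> 2"
    and xs: "distinct xs" "set xs = pverts G - {c}"
    and path: "successively (\<lambda>u v. (u, v) \<notin> parcs G) xs"
  shows "lambda_number G \<le> card (pverts G)"
proof -
  let ?V = "pverts G"
  define m where "m = length xs"
  have m: "card ?V = Suc m"
    using xs c distinct_card[OF xs(1)] card by (simp add: m_def)
  have "m > 0" using m card by simp
  define pos where "pos = inv_into {..<m} ((!) xs)"
  have bij: "bij_betw ((!) xs) {..<m} (?V - {c})"
    using bij_betw_nth[OF xs(1)] xs(2) by (simp add: m_def)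
  have pos: "pos v < m" "xs ! pos v = v" if "v \<in> ?V - {c}" for v
    using bij_betw_inv_into_right[OF bij that] bij_betw_apply[OF bij_betw_inv_into[OF bij] that]
    by (auto simp: pos_def)
  have pos_nth: "pos (xs ! i) = i" if "i < m" for i
    using bij_betw_inv_into_left[OF bij] that by (simp add: pos_def)
  have nadj: "(xs ! i, xs ! Suc i) \<notin> parcs G" if "Suc i < m" for i
    using successively_nth[OF path] that by (simp add: m_def)
  define f where "f v = (if v = c then int m + 1 else int (pos v))" for v
  have apart: "\<bar>f u - f v\<bar> \<ge> 1" if "u \<in> ?V" "v \<in> ?V" "u \<noteq> v" for u v
  proof -
    have "pos u \<noteq> pos v" if "u \<noteq> c" "v \<noteq> c"
      using that \<open>u \<in> ?V\<close> \<open>v \<in> ?V\<close> \<open>u \<noteq> v\<close> pos(2)[of u] pos(2)[of v] by force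
    then show ?thesis
      using that pos(1)[of u] pos(1)[of v] by (auto simp: f_def)
  qed
  have "L21_labeling G f"
    unfolding L21_labeling_def
  proof (intro ballI conjI impI)
    fix u v assume uv: "u \<in> ?V" "v \<in> ?V"
    show "\<bar>f u - f v\<bar> \<ge> 2" if adj: "(u, v) \<in> parcs G"
    proof (cases "u = c \<or> v = c")
      case True
      then show ?thesis
        using uv pair_no_loops[OF adj] pos[of u] pos[of v] by (auto simp: f_def)
    next
      case False
      then have p: "pos u < m" "xs ! pos u = u" "pos v < m" "xs ! pos v = v"
        using pos uv by auto
      have "(v, u) \<in> parcs G"
        using adj arcs_symmetric by blast
      then have "pos u \<noteq> Suc (pos v)" "pos v \<noteq> Suc (pos u)"
        using nadj[of "pos u"] nadj[of "pos v"] adj p by metis+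
      moreover have "pos u \<noteq> pos v"
        using p pair_no_loops[OF adj] by (metis fst_conv snd_conv)
      ultimately show ?thesis
        using False by (auto simp: f_def)
    qed
    show "\<bar>f u - f v\<bar> \<ge> 1" if "graph_dist G u v = 2"
      using apart[OF uv] graph_dist_refl[OF uv(1)] that by fastforce
  qed
  moreover have "labeling_span G f = int (card ?V)"
  proof -
    have "Max (f ` ?V) = int m + 1"
    proof (intro Max_eqI)
      show "y \<le> int m + 1" if "y \<in> f ` ?V" for y
        using that pos(1) by (force simp: f_def)
    qed (use c in \<open>auto simp: f_def\<close>)
    moreover have "Min (f ` ?V) = 0"
    proof (intro Min_eqI)
      have "xs ! 0 \<in> ?V - {c}"
        using bij_betw_apply[OF bij] \<open>m > 0\<close> by blast
      then show "0 \<in> f ` ?V"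
        using pos_nth[OF \<open>m > 0\<close>] by (force simp: f_def image_iff)
    qed (auto simp: f_def)
    ultimately show ?thesis
      by (simp add: labeling_span_def m)
  qed
  ultimately show ?thesis
    unfolding lambda_number_def by (blast intro: Least_le)
qed

lemma (in pair_graph) lambda_number_ge_complete:
  assumes ne: "pverts G \<noteq> {}"
    and complete: "\<And>u v. u \<in> pverts G \<Longrightarrow> v \<in> pverts G \<Longrightarrow> u \<noteq> v \<Longrightarrow> (u, v) \<in> parcs G"
  shows "2 * card (pverts G) \<le> lambda_number G + 2"
proof -
  let ?V = "pverts G"
  obtain f where f: "L21_labeling G f" and span: "labeling_span G f = int (lambda_number G)"
    using lambda_number_attained[OF pair_graph] ne by blast
  define a where "a = Min (f ` ?V)"
  define L where "L = int (lambda_number G)"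
  have range: "f ` ?V \<subseteq> {a..a + L}"
    using labels_in_span[of G f] by (simp add: span a_def L_def)
  \<comment> \<open>Labels pairwise at least 2 apart stay distinct after halving.\<close>
  define h where "h v = (f v - a) div 2" for v
  have "inj_on h ?V"
  proof (rule inj_onI, rule ccontr)
    fix u v assume uv: "u \<in> ?V" "v \<in> ?V" "h u = h v" "u \<noteq> v"
    then have "\<bar>f u - f v\<bar> \<ge> 2"
      using f complete by (auto simp: L21_labeling_def)
    then show False
      using \<open>h u = h v\<close> unfolding h_def by presburger
  qed
  then have "card ?V = card (h ` ?V)"
    by (simp add: card_image)
  also have "\<dots> \<le> card {0..L div 2}"
    proof (intro card_mono)
    show "h ` ?V \<subseteq> {0..L div 2}"
    proof (rule image_subsetI)
      fix v assume "v \<in> ?V"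
      then have "f v \<in> {a..a + L}"
        using range by blast
      then show "h v \<in> {0..L div 2}"
        by (auto simp: h_def intro: zdiv_mono1)
    qed
  qed simp
  also have "\<dots> = nat (L div 2 + 1)"
    by simp
  finally show ?thesis
    unfolding L_def by linarith
qed

section \<open>Centralizers in simple groups\<close>

lemma (in group) subgroup_centralizer:
  assumes "x \<in> carrier G"
  shows "subgroup {y \<in> carrier G. x \<otimes> y = y \<otimes> x} G"
proof (rule subgroupI)
  fix a b assume a: "a \<in> {y \<in> carrier G. x \<otimes> y = y \<otimes> x}"
  show "inv a \<in> {y \<in> carrier G. x \<otimes> y = y \<otimes> x}"
    using a assms by (auto simp: inv_solve_left inv_solve_right' m_assoc[symmetric])
      (metis inv_closed inv_solve_right m_assoc m_closed)
  assume b: "b \<in> {y \<in> carrier G. x \<otimes> y = y \<otimes> x}"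
  have "x \<otimes> (a \<otimes> b) = a \<otimes> b \<otimes> x"
  proof -
    have ab: "a \<in> carrier G" "b \<in> carrier G" "x \<otimes> a = a \<otimes> x" "x \<otimes> b = b \<otimes> x"
      using a b by auto
    then have "x \<otimes> (a \<otimes> b) = a \<otimes> x \<otimes> b"
      using assms by (simp add: m_assoc[symmetric])
    also have "\<dots> = a \<otimes> b \<otimes> x"
      using ab assms by (simp add: m_assoc)
    finally show ?thesis .
  qed
  then show "a \<otimes> b \<in> {y \<in> carrier G. x \<otimes> y = y \<otimes> x}"
    using a b by simp
qed (use assms in auto)

lemma (in group) normal_center:
  "{z \<in> carrier G. \<forall>y \<in> carrier G. z \<otimes> y = y \<otimes> z} \<lhd> G" (is "?Z \<lhd> G")
proof -
  have "?Z = (\<Inter>x \<in> carrier G. {y \<in> carrier G. x \<otimes> y = y \<otimes> x})"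
    using one_closed by auto
  then have "subgroup ?Z G"
    using subgroup_centralizer by (auto intro!: subgroups_Inter)
  moreover have "x \<otimes> z \<otimes> inv x = z" if "x \<in> carrier G" "z \<in> ?Z" for x z
  proof -
    have "z \<in> carrier G" "x \<otimes> z = z \<otimes> x"
      using that by auto
    then show ?thesis
      using that(1) by (simp add: m_assoc)
  qed
  ultimately show ?thesis
    unfolding normal_inv_iff by (metis (lifting))
qed

lemma (in simple_group) commutative_imp_cyclic:
  assumes comm: "\<And>x y. x \<in> carrier G \<Longrightarrow> y \<in> carrier G \<Longrightarrow> x \<otimes> y = y \<otimes> x"
  shows "cyclic_group G"
proof -
  obtain x where x: "x \<in> carrier G" "x \<noteq> \<one>"
    using simple_not_triv one_closed by blast
  have sub: "subgroup (generate G {x}) G"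
    using x by (intro generate_is_subgroup) simp
  interpret comm_group G
    using comm by (rule group_comm_groupI)
  have "generate G {x} \<lhd> G"
    using sub by (rule subgroup_imp_normal)
  moreover have "x \<in> generate G {x}"
    by (rule generate.incl) simp
  ultimately have "generate G {x} = carrier G"
    using no_real_normal_subgroup x by blast
  then show ?thesis
    using x generate_pow[OF x(1)] by (auto simp: cyclic_group full_SetCompr_eq)
qed

lemma (in simple_group) centralizer_proper:
  assumes "\<not> cyclic_group G" and "x \<in> carrier G" and "x \<noteq> \<one>"
  shows "{y \<in> carrier G. x \<otimes> y = y \<otimes> x} \<noteq> carrier G"
proof
  assume "{y \<in> carrier G. x \<otimes> y = y \<otimes> x} = carrier G"
  then have "x \<in> {z \<in> carrier G. \<forall>y \<in> carrier G. z \<otimes> y = y \<otimes> z}"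
    using assms by auto
  then have "{z \<in> carrier G. \<forall>y \<in> carrier G. z \<otimes> y = y \<otimes> z} = carrier G"
    using no_real_normal_subgroup[OF normal_center] assms by blast
  then show False
    using commutative_imp_cyclic assms(1) by blast
qed

lemma (in group) card_proper_subgroup_le_half:
  assumes fin: "finite (carrier G)" and H: "subgroup H G" "H \<noteq> carrier G"
  shows "2 * card H \<le> order G"
proof -
  have "card H < order G"
    using fin H by (metis order_def psubset_card_mono psubsetI subgroup.subset)
  moreover have eq: "card (rcosets H) * card H = order G"
    using lagrange[OF H(1)] .
  ultimately have "card (rcosets H) \<noteq> 0" "card (rcosets H) \<noteq> 1"
    by (auto intro!: Nat.gr0I)
  then have "2 \<le> card (rcosets H)"
    by linarith
  then show ?thesis
    using eq by (metis mult_le_mono1)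
qed

section \<open>The enhanced power graph of a simple group\<close>

lemma (in group) enhanced_power_graph_adj_commute:
  assumes "(x, y) \<in> parcs (enhanced_power_graph G)"
  shows "x \<otimes> y = y \<otimes> x"
proof -
  from assms obtain z where z: "z \<in> carrier G" "x \<in> generate G {z}" "y \<in> generate G {z}"
    by (auto simp: enhanced_power_graph_def)
  then obtain i j :: int where "x = z [^] i" "y = z [^] j"
    by (auto simp: generate_pow)
  then show ?thesis
    using z(1) by (simp add: int_pow_mult[symmetric] add.commute)
qed

lemma (in group) enhanced_power_graph_one_adj:
  assumes "x \<in> carrier G - {\<one>}"
  shows "(\<one>, x) \<in> parcs (enhanced_power_graph G)"
  using assms by (auto simp: enhanced_power_graph_def intro!: bexI[of _ x] generate.one generate.incl)

lemma (in group) enhanced_power_graph_cyclic_complete: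
  assumes "cyclic_group G" and "x \<in> carrier G" and "y \<in> carrier G" and "x \<noteq> y"
  shows "(x, y) \<in> parcs (enhanced_power_graph G)"
proof -
  obtain z where z: "z \<in> carrier G" "carrier G = range (\<lambda>k::int. z [^] k)"
    using assms(1) by (auto simp: cyclic_group)
  then have "generate G {z} = carrier G"
    by (auto simp: generate_pow)
  then show ?thesis
    using assms z(1) by (auto simp: enhanced_power_graph_def)
qed

lemma (in simple_group) hamiltonian_path_noncyclic:
  assumes fin: "finite (carrier G)" and nc: "\<not> cyclic_group G"
  obtains xs where "distinct xs" and "set xs = carrier G - {\<one>}"
    and "successively (\<lambda>x y. (x, y) \<notin> parcs (enhanced_power_graph G)) xs"
proof -
  let ?E = "parcs (enhanced_power_graph G)"
  let ?V = "carrier G - {\<one>}"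
  define R where "R x y \<longleftrightarrow> x \<noteq> y \<and> (x, y) \<notin> ?E" for x y
  have sym: "symp R"
    by (auto simp: R_def enhanced_power_graph_def intro!: sympI)
  have irrefl: "\<not> R x x" for x
    by (simp add: R_def)
  have ne: "?V \<noteq> {}"
    using simple_not_triv one_closed by blast
  have deg: "card ?V \<le> 2 * card {y \<in> ?V. R x y}" if x: "x \<in> ?V" for x
  proof -
    define C where "C = {y \<in> carrier G. x \<otimes> y = y \<otimes> x}"
    have C: "subgroup C G" "C \<noteq> carrier G"
      using subgroup_centralizer centralizer_proper[OF nc] x by (auto simp: C_def)
    have "carrier G - C \<subseteq> {y \<in> ?V. R x y}"
      using x enhanced_power_graph_adj_commute by (auto simp: C_def R_def)
    then have "card (carrier G - C) \<le> card {y \<in> ?V. R x y}"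
      using fin by (intro card_mono) auto
    moreover have "card (carrier G - C) = order G - card C"
      using fin by (simp add: order_def card_Diff_subset C_def)
    moreover have "2 * card C \<le> order G"
      using card_proper_subgroup_le_half[OF fin C] .
    moreover have "card ?V \<le> order G"
      using fin by (simp add: order_def card_Diff1_le)
    ultimately show ?thesis by linarith
  qed
  obtain xs where "distinct xs" "set xs = ?V" and path: "successively R xs"
    by (rule dirac_hamiltonian_cycle[OF finite_Diff[OF fin] ne sym irrefl deg])
  moreover have "successively (\<lambda>x y. (x, y) \<notin> ?E) xs"
    using path by (rule successively_mono) (simp add: R_def)
  ultimately show thesis
    using that by blast
qed

theorem theorem3p6:
  fixes G :: "('a, 'b) monoid_scheme" and n :: nat
  assumes "simple_group G" and "finite (carrier G)" and "order G = n"
  shows "lambda_number (enhanced_power_graph G) = n \<longleftrightarrow> \<not> (cyclic_group G \<and> n \<ge> 3)"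
proof -
  interpret simple_group G by fact
  let ?\<Gamma> = "enhanced_power_graph G"
  interpret \<Gamma>: pair_graph ?\<Gamma>
    using assms(2) by (rule pair_graph_enhanced_power_graph)
  have V: "pverts ?\<Gamma> = carrier G"
    by (simp add: enhanced_power_graph_def)
  have card: "card (pverts ?\<Gamma>) = n" and n: "n \<ge> 2"
    using assms(3) order_gt_one by (auto simp: V order_def)
  have lower: "n \<le> lambda_number ?\<Gamma>"
    using \<Gamma>.lambda_number_ge_dominated[of "\<one>\<^bsub>G\<^esub>"] enhanced_power_graph_one_adj card n
    by (simp add: V)
  have upper: "lambda_number ?\<Gamma> \<le> n"
    if "distinct xs" "set xs = carrier G - {\<one>\<^bsub>G\<^esub>}" "successively (\<lambda>x y. (x, y) \<notin> parcs ?\<Gamma>) xs" for xs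
    using \<Gamma>.lambda_number_le_hamiltonian[of "\<one>\<^bsub>G\<^esub>" xs] that card n by (simp add: V)
  show ?thesis
  proof (cases "cyclic_group G")
    case True
    show ?thesis
    proof (cases "n \<ge> 3")
      case n3: True
      have "2 * n \<le> lambda_number ?\<Gamma> + 2"
        using \<Gamma>.lambda_number_ge_complete enhanced_power_graph_cyclic_complete[OF True] card
          one_closed by (force simp: V)
      then show ?thesis
        using True n3 by simp
    next
      case False
      then have "card (carrier G - {\<one>\<^bsub>G\<^esub>}) = 1"
        using n card by (simp add: V)
      then obtain x where "carrier G - {\<one>\<^bsub>G\<^esub>} = {x}"
        by (rule card_1_singletonE)
      then have "lambda_number ?\<Gamma> \<le> n"
        by (intro upper[of "[x]"]) auto
      then show ?thesis
        using lower False by simp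
    qed
  next
    case False
    then have "lambda_number ?\<Gamma> \<le> n"
      using hamiltonian_path_noncyclic[OF assms(2)] upper by metis
    then show ?thesis
      using lower False by simp
  qed
qed

end
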